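(* Let $\Omega\subset\mathbb{R}^n$ be compact, $f\in C(\Omega)$ real-valued with global minimum value $f^*=\min_{x\in\Omega}f(x)$, $\rho:\mathbb{R}\to\mathbb{R}$ monotonically (strictly) decreasing with $\rho(f(x))>0$ for every $x\in\Omega$, $\tau(x)=\rho(f(x))$, and $m^{(k)}(x)=\tau^k(x)/\int_\Omega\tau^k(t)\,\mathrm{d}t$ for $x\in\Omega$, $k\in\mathbb{R}$. Then $$\lim_{k\to\infty}\int_\Omega f(x)\,m^{(k)}(x)\,\mathrm{d}x=f^*;$$ moreover, if $x^*$ is the unique global minimizer of $f$ in $\Omega$, then $$\lim_{k\to\infty}\int_\Omega x\cdot m^{(k)}(x)\,\mathrm{d}x=x^*.$$
   Context: Integrals are with respect to $n$-dimensional Lebesgue measure $\mu$; it is implicit in the definition of $m^{(k)}$ that $\mu(\Omega)>0$. The second integral is the vector-valued integral of $x\mapsto m^{(k)}(x)x\in\mathbb{R}^n$. A typical choice of $\tau$ is the exponential type $\tau(x)=e^{-f(x)}$.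
   Formalization: Added assumption: some global minimizer x of f has μ(Ω ∩ B(x,r)) > 0 for every r > 0; without it the claim fails, e.g. Ω = [0,1] ∪ {2}, f(x) = −x, ρ(y) = e^{−y}. *)

theory Defs
  imports "HOL-Analysis.Analysis"
begin

definition min_value :: "('a \<Rightarrow> real) \<Rightarrow> 'a set \<Rightarrow> real" where
  "min_value f \<Omega> = (LEAST y. y \<in> f ` \<Omega>)"

definition global_minimizer :: "('a \<Rightarrow> real) \<Rightarrow> 'a set \<Rightarrow> 'a \<Rightarrow> bool" where
  "global_minimizer f \<Omega> x \<longleftrightarrow> is_arg_min f (\<lambda>t. t \<in> \<Omega>) x"

definition unique_global_minimizer :: "('a \<Rightarrow> real) \<Rightarrow> 'a set \<Rightarrow> 'a \<Rightarrow> bool" where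
  "unique_global_minimizer f \<Omega> x \<longleftrightarrow>
     global_minimizer f \<Omega> x \<and> (\<forall>y. global_minimizer f \<Omega> y \<longrightarrow> y = x)"

(* The exponent k is real; powr agrees with the usual real power wherever \<tau> is positive,
   and the density is only used at points of \<Omega>. *)
definition minima_density :: "(real ^ 'n) set \<Rightarrow> (real ^ 'n \<Rightarrow> real) \<Rightarrow> real \<Rightarrow> real ^ 'n \<Rightarrow> real" where
  "minima_density \<Omega> \<tau> k x = \<tau> x powr k / (LINT t:\<Omega>|lebesgue. \<tau> t powr k)"

(* x lies in the support of Lebesgue measure restricted to \<Omega>. A minimizer off this support is
   invisible to integrals over \<Omega>: for \<Omega> = {0..1} \<union> {2} on the line, f x = - x and
   \<rho> y = exp (- y), the densities concentrate at 1, whereas f is minimal at 2. Hence compactness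
   and positive measure of \<Omega> alone do not make the mean of f converge to the minimum. *)
definition in_measure_support :: "(real ^ 'n) set \<Rightarrow> real ^ 'n \<Rightarrow> bool" where
  "in_measure_support \<Omega> x \<longleftrightarrow> (\<forall>r>0. measure lebesgue (\<Omega> \<inter> ball x r) > 0)"

end

theory Submission
  imports Defs "HOL-Real_Asymp.Real_Asymp"
begin

text \<open>
  The density \<open>m\<^bsup>(k)\<^esup>\<close> concentrates where \<open>\<tau>\<close> is large: if \<open>\<tau> \<ge> a\<close> on a set \<open>A\<close> of positive measure,
  then \<open>m\<^bsup>(k)\<^esup> \<le> (b/a)\<^sup>k / \<mu>(A)\<close> wherever \<open>\<tau> \<le> b < a\<close>, and this tends to 0 uniformly. Continuity of \<open>f\<close> at a
  minimizer in the support makes \<open>{f \<le> f\<^sup>* + \<eta>}\<close> such a set \<open>A\<close>, and strict monotonicity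
  of \<open>\<rho>\<close> gives the gap between \<open>\<rho>(f\<^sup>* + \<eta>)\<close> and \<open>\<rho>(f\<^sup>* + 2\<eta>)\<close>; no continuity of \<open>\<rho>\<close> is used.
\<close>

lemma (in finite_measure) integrable_bounded:
  fixes h :: "'a \<Rightarrow> 'b::{banach,second_countable_topology}"
  assumes "h \<in> borel_measurable M" "\<And>x. x \<in> space M \<Longrightarrow> norm (h x) \<le> B"
  shows "integrable M h"
  using assms by (intro integrable_const_bound[of _ B]) auto

text \<open>Assumption \<open>conc\<close> isolates all that is needed of \<open>u\<close> and
  \<open>g\<close>: where \<open>u\<close> exceeds \<open>b\<close>, \<open>g\<close> is already
  close to \<open>L\<close>, and where \<open>u\<close> is at most \<open>b < a\<close>, the weight
  decays like \<open>(b/a) powr k\<close>. Letting \<open>g\<close> be vector-valued makes both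
  limits of the theorem instances of this one.\<close>

lemma (in finite_measure) normalized_powr_concentrates:
  fixes u :: "'a \<Rightarrow> real" and g :: "'a \<Rightarrow> 'b::{banach,second_countable_topology}"
  assumes u[measurable]: "u \<in> borel_measurable M"
    and g[measurable]: "g \<in> borel_measurable M"
    and u_pos: "\<And>x. x \<in> space M \<Longrightarrow> 0 < u x"
    and u_le: "\<And>x. x \<in> space M \<Longrightarrow> u x \<le> U"
    and g_le: "\<And>x. x \<in> space M \<Longrightarrow> norm (g x) \<le> B"
    and conc: "\<And>\<epsilon>. \<epsilon> > 0 \<Longrightarrow> \<exists>a b. 0 < b \<and> b < a \<and> 0 < measure M {x \<in> space M. a \<le> u x} \<and>
                 (\<forall>x \<in> space M. b < u x \<longrightarrow> norm (g x - L) \<le> \<epsilon>)"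
  shows "((\<lambda>k. LINT x|M. (u x powr k / (LINT t|M. u t powr k)) *\<^sub>R g x) \<longlongrightarrow> L) at_top"
proof (rule tendstoI)
  fix e :: real assume "e > 0"
  then obtain a b where ab: "0 < b" "b < a" and A: "0 < measure M {x \<in> space M. a \<le> u x}"
    and near: "\<And>x. x \<in> space M \<Longrightarrow> b < u x \<Longrightarrow> norm (g x - L) \<le> e/2"
    using conc[of "e/2"] by auto
  \<comment> \<open>\<open>\<alpha>\<close> is the mass of the high level set, \<open>C\<close>
    bounds \<open>norm (g x - L)\<close> on the whole space, and \<open>q\<close> is the decay ratio
    of the weight outside \<open>{b < u}\<close>.\<close>
  define \<alpha> where "\<alpha> = measure M {x \<in> space M. a \<le> u x}"
  define C where "C = \<bar>B\<bar> + norm L"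
  define q where "q = b / a"
  have q: "0 < q" "q < 1" using ab by (auto simp: q_def)
  have "((\<lambda>k. C * measure M (space M) / \<alpha> * q powr k) \<longlongrightarrow> 0) at_top"
    by (rule tendsto_mult_right_zero) (use q in real_asymp)
  then have "\<forall>\<^sub>F k in at_top. C * measure M (space M) / \<alpha> * q powr k < e/2"
    using \<open>e > 0\<close> by (intro order_tendstoD(2)[where y = 0]) auto
  \<comment> \<open>For negative \<open>k\<close> the map \<open>t powr k\<close> would be
    decreasing in \<open>t\<close>, so the comparisons of powers below would be reversed.\<close>
  moreover have "\<forall>\<^sub>F k in at_top. (0::real) \<le> k"
    by (rule eventually_ge_at_top)
  ultimately show "\<forall>\<^sub>F k in at_top.
      dist (LINT x|M. (u x powr k / (LINT t|M. u t powr k)) *\<^sub>R g x) L < e"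
  proof eventually_elim
    fix k :: real
    assume small: "C * measure M (space M) / \<alpha> * q powr k < e/2" and k: "0 \<le> k"
    define J where "J = (LINT t|M. u t powr k)"
    define m where "m = (\<lambda>x. u x powr k / J)"
    have int_u: "integrable M (\<lambda>x. u x powr k)"
      by (rule integrable_bounded[of _ "U powr k"])
        (use u_pos u_le k in \<open>auto intro!: powr_mono2 simp: less_imp_le\<close>)
    \<comment> \<open>A Markov-type bound: integrating only over \<open>{a \<le> u}\<close> bounds
      the normalizer \<open>J\<close> from below, which also gives \<open>J > 0\<close>.\<close>
    have "a powr k * \<alpha> = (LINT x|M. a powr k * indicator {x \<in> space M. a \<le> u x} x)"
      by (simp add: \<alpha>_def)
    also have "\<dots> \<le> J"
      unfolding J_def
    proof (rule integral_mono[OF _ int_u])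
      show "integrable M (\<lambda>x. a powr k * indicator {x \<in> space M. a \<le> u x} x :: real)"
        by (rule integrable_bounded[of _ "a powr k"]) (auto simp: indicator_def)
    qed (use ab k in \<open>auto simp: indicator_def intro!: powr_mono2\<close>)
    finally have J_ge: "a powr k * \<alpha> \<le> J" .
    have a\<alpha>: "0 < a powr k * \<alpha>" using A ab by (simp add: \<alpha>_def)
    then have J: "J > 0" using J_ge by linarith
    have m_nonneg: "m x \<ge> 0" for x using J by (simp add: m_def)
    have m_meas[measurable]: "m \<in> borel_measurable M"
      unfolding m_def by measurable
    have m_le: "m x \<le> U powr k / J" if "x \<in> space M" for x
      using that u_pos[OF that] u_le[OF that] k J
      by (auto simp: m_def intro!: divide_right_mono powr_mono2)
    have int_m: "integrable M m"
      unfolding m_def using int_u by simp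
    have m_one: "(LINT x|M. m x) = 1"
      using J by (simp add: m_def J_def)
    have int_mg: "integrable M (\<lambda>x. m x *\<^sub>R g x)"
    proof (rule integrable_bounded)
      fix x assume x: "x \<in> space M"
      show "norm (m x *\<^sub>R g x) \<le> U powr k / J * B"
        using mult_mono'[OF m_le[OF x] g_le[OF x] m_nonneg norm_ge_zero] m_nonneg[of x] by simp
    qed measurable
    \<comment> \<open>As \<open>m\<close> has total mass 1, the constant \<open>L\<close> can be
      moved under the integral.\<close>
    have eq: "(LINT x|M. m x *\<^sub>R g x) - L = (LINT x|M. m x *\<^sub>R (g x - L))"
      using int_m int_mg m_one by (simp add: scaleR_diff_right)
    have int_mgL: "integrable M (\<lambda>x. m x *\<^sub>R (g x - L))"
      using int_m int_mg by (simp add: scaleR_diff_right)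
    have C: "norm (g x - L) \<le> C" if "x \<in> space M" for x
      using g_le[OF that] norm_triangle_ineq4[of "g x" L] by (simp add: C_def)
    \<comment> \<open>The first summand covers \<open>b < u x\<close>, the second covers
      \<open>u x \<le> b\<close>, where \<open>m x\<close> is at most \<open>b powr k\<close> over
      the lower bound of \<open>J\<close>. Adding both nonnegative terms gives one bound valid
      everywhere, so the domain of integration need not be split.\<close>
    have pw: "norm (m x *\<^sub>R (g x - L)) \<le> e/2 * m x + C / \<alpha> * q powr k" if x: "x \<in> space M" for x
    proof (cases "b < u x")
      case True
      have "m x * norm (g x - L) \<le> m x * (e/2)"
        using near[OF x True] m_nonneg by (intro mult_left_mono) auto
      moreover have "0 \<le> C / \<alpha> * q powr k"
        by (simp add: C_def \<alpha>_def)
      ultimately show ?thesis using m_nonneg[of x] by (simp add: mult.commute)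
    next
      case False
      have "m x \<le> b powr k / (a powr k * \<alpha>)"
        unfolding m_def using False u_pos[OF x] k J_ge a\<alpha>
        by (intro frac_le powr_mono2) auto
      also have "\<dots> = q powr k / \<alpha>"
        using ab by (simp add: q_def powr_divide)
      finally have "m x * norm (g x - L) \<le> q powr k / \<alpha> * C"
        using C[OF x] m_nonneg[of x] by (intro mult_mono) (auto simp: \<alpha>_def)
      then show ?thesis using m_nonneg[of x] \<open>e > 0\<close>
        by (simp add: mult.commute add_increasing)
    qed
    have "norm ((LINT x|M. m x *\<^sub>R g x) - L) \<le> (LINT x|M. norm (m x *\<^sub>R (g x - L)))"
      unfolding eq by (rule integral_norm_bound)
    also have "\<dots> \<le> (LINT x|M. e/2 * m x + C / \<alpha> * q powr k)"
      using int_m pw by (intro integral_mono integrable_norm[OF int_mgL]) auto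
    also have "\<dots> = e/2 + C * measure M (space M) / \<alpha> * q powr k"
      using int_m m_one by simp
    also have "\<dots> < e" using small by linarith
    finally show "dist (LINT x|M. (u x powr k / (LINT t|M. u t powr k)) *\<^sub>R g x) L < e"
      by (simp add: dist_norm m_def J_def)
  qed
qed

lemma global_minimizer_iff:
  fixes f :: "'a \<Rightarrow> real"
  shows "global_minimizer f \<Omega> x \<longleftrightarrow> x \<in> \<Omega> \<and> (\<forall>y\<in>\<Omega>. f x \<le> f y)"
  by (auto simp: global_minimizer_def is_arg_min_linorder)

lemma min_value_eq:
  assumes "global_minimizer f \<Omega> x"
  shows "min_value f \<Omega> = f x"
  using assms unfolding min_value_def global_minimizer_iff
  by (intro Least_equality) auto

lemma set_lebesgue_integral_lebesgue_on:
  fixes h :: "'a::euclidean_space \<Rightarrow> 'b::{banach,second_countable_topology}"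
  assumes "S \<in> sets lebesgue"
  shows "(LINT x:S|lebesgue. h x) = (LINT x|lebesgue_on S. h x)"
  using assms by (simp add: set_lebesgue_integral_def integral_restrict_space)

text \<open>The hypothesis \<open>near\<close> asks that almost minimal values of \<open>f\<close>
  force \<open>g\<close> close to \<open>L\<close>. It is meant for \<open>g = f\<close> with
  \<open>L = f z\<close>, and for \<open>g\<close> the identity with \<open>L\<close> the unique
  minimizer.\<close>

lemma minima_density_concentrates:
  fixes \<Omega> :: "(real ^ 'n) set" and g :: "real ^ 'n \<Rightarrow> 'b::{banach,second_countable_topology}"
  assumes comp: "compact \<Omega>"
    and f: "continuous_on \<Omega> f"
    and g: "continuous_on \<Omega> g"
    and rho: "strict_antimono_on UNIV \<rho>"
    and pos: "\<And>x. x \<in> \<Omega> \<Longrightarrow> \<rho> (f x) > 0"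
    and z: "global_minimizer f \<Omega> z" "in_measure_support \<Omega> z"
    and near: "\<And>\<epsilon>. \<epsilon> > 0 \<Longrightarrow> \<exists>\<delta>>0. \<forall>x\<in>\<Omega>. f x < f z + \<delta> \<longrightarrow> dist (g x) L \<le> \<epsilon>"
  shows "((\<lambda>k. LINT x:\<Omega>|lebesgue. minima_density \<Omega> (\<lambda>t. \<rho> (f t)) k x *\<^sub>R g x) \<longlongrightarrow> L) at_top"
proof -
  define M where "M = lebesgue_on \<Omega>"
  have lm: "\<Omega> \<in> lmeasurable" using comp by (rule lmeasurable_compact)
  then have \<Omega>: "\<Omega> \<in> sets lebesgue" by (rule fmeasurableD)
  have space_M: "space M = \<Omega>" by (simp add: M_def)
  interpret finite_measure M
    unfolding M_def using lm by (rule finite_measure_lebesgue_on)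
  have z\<Omega>: "z \<in> \<Omega>" and zmin: "\<And>x. x \<in> \<Omega> \<Longrightarrow> f z \<le> f x"
    using z(1) by (auto simp: global_minimizer_iff)
  have f_meas[measurable]: "f \<in> borel_measurable M"
    unfolding M_def using f \<Omega> by (rule continuous_imp_measurable_on_sets_lebesgue)
  have g_meas: "g \<in> borel_measurable M"
    unfolding M_def using g \<Omega> by (rule continuous_imp_measurable_on_sets_lebesgue)
  have rho_less: "\<rho> y < \<rho> x" if "x < y" for x y
    using rho that by (auto simp: monotone_on_def)
  then have rho_le: "\<rho> y \<le> \<rho> x" if "x \<le> y" for x y
    using that by (cases "x = y") (auto simp: less_imp_le)
  \<comment> \<open>Measurability of \<open>\<rho>\<close> comes from monotonicity; the sign change
    turns a decreasing function into an increasing one.\<close>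
  have "mono (\<lambda>y. - \<rho> y)"
    by (rule monoI) (simp add: rho_le)
  then have "(\<lambda>y. - \<rho> y) \<in> borel_measurable borel"
    by (rule borel_measurable_mono)
  then have rho_meas[measurable]: "\<rho> \<in> borel_measurable borel"
    by simp
  obtain w where w: "w \<in> \<Omega>" "\<And>x. x \<in> \<Omega> \<Longrightarrow> f x \<le> f w"
    using continuous_attains_sup[OF comp _ f] z\<Omega> by blast
  obtain B where B: "\<And>x. x \<in> \<Omega> \<Longrightarrow> norm (g x) \<le> B"
    using compact_imp_bounded[OF compact_continuous_image[OF g comp]] by (auto simp: bounded_iff)
  have "((\<lambda>k. LINT x|M. (\<rho> (f x) powr k / (LINT t|M. \<rho> (f t) powr k)) *\<^sub>R g x) \<longlongrightarrow> L) at_top"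
  proof (rule normalized_powr_concentrates[OF _ g_meas])
    fix \<epsilon> :: real assume "\<epsilon> > 0"
    then obtain \<delta> where \<delta>: "\<delta> > 0" and g_near: "\<And>x. x \<in> \<Omega> \<Longrightarrow> f x < f z + \<delta> \<Longrightarrow> dist (g x) L \<le> \<epsilon>"
      using near by meson
    \<comment> \<open>The maximum guards against \<open>\<rho> (f z + \<delta>/2)\<close> being nonpositive, which may happen
        when \<open>f z + \<delta>/2\<close> exceeds the range of \<open>f\<close>.\<close>
    define a where "a = max (\<rho> (f z + \<delta>/2)) (\<rho> (f w))"
    \<comment> \<open>Taking the maximum with \<open>a/2\<close> keeps \<open>b\<close> positive and
      below \<open>a\<close>, even if \<open>\<rho> (f z + \<delta>)\<close> is nonpositive.\<close>
    define b where "b = max (\<rho> (f z + \<delta>)) (a/2)"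
    have "a > 0" using pos[OF w(1)] by (auto simp: a_def)
    moreover have "\<rho> (f z + \<delta>) < a"
      using rho_less[of "f z + \<delta>/2" "f z + \<delta>"] \<delta> by (simp add: a_def)
    ultimately have ab: "0 < b" "b < a" by (auto simp: b_def)
    obtain r where r: "r > 0" "\<And>x. x \<in> \<Omega> \<Longrightarrow> dist x z < r \<Longrightarrow> dist (f x) (f z) < \<delta>/2"
      using f z\<Omega> \<delta> unfolding continuous_on_iff by (metis half_gt_zero)
    have "0 < measure lebesgue (\<Omega> \<inter> ball z r)"
      using z(2) r(1) by (simp add: in_measure_support_def)
    also have "\<dots> = measure M (\<Omega> \<inter> ball z r)"
      unfolding M_def using \<Omega> by (simp add: measure_restrict_space)
    also have "\<dots> \<le> measure M {x \<in> space M. a \<le> \<rho> (f x)}"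
    proof (rule finite_measure_mono)
      \<comment> \<open>Near \<open>z\<close>, \<open>f\<close> is at most
        \<open>f z + \<delta>/2\<close>, so \<open>\<rho> (f x)\<close> dominates the first entry of
        the maximum \<open>a\<close>; it dominates the second on all of \<open>\<Omega>\<close>,
        since \<open>f\<close> is largest at \<open>w\<close>.\<close>
      show "\<Omega> \<inter> ball z r \<subseteq> {x \<in> space M. a \<le> \<rho> (f x)}"
      proof
        fix x assume x: "x \<in> \<Omega> \<inter> ball z r"
        then have "dist (f x) (f z) < \<delta>/2" by (intro r(2)) (auto simp: dist_commute)
        then have "f x \<le> f z + \<delta>/2" by (simp add: dist_real_def abs_if split: if_splits)
        then show "x \<in> {x \<in> space M. a \<le> \<rho> (f x)}"
          using x w(2)[of x] by (auto simp: a_def space_M intro: rho_le)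
      qed
    qed measurable
    finally have "0 < measure M {x \<in> space M. a \<le> \<rho> (f x)}" .
    moreover have "norm (g x - L) \<le> \<epsilon>" if x: "x \<in> space M" "b < \<rho> (f x)" for x
    proof -
      \<comment> \<open>Otherwise
        \<open>\<rho> (f x) \<le> \<rho> (f z + \<delta>) \<le> b\<close>.\<close>
      have "\<not> f z + \<delta> \<le> f x" using rho_le[of "f z + \<delta>" "f x"] x(2) by (auto simp: b_def)
      then show ?thesis using g_near[of x] x(1) by (simp add: space_M dist_norm)
    qed
    ultimately show "\<exists>a b. 0 < b \<and> b < a \<and> 0 < measure M {x \<in> space M. a \<le> \<rho> (f x)} \<and>
        (\<forall>x\<in>space M. b < \<rho> (f x) \<longrightarrow> norm (g x - L) \<le> \<epsilon>)"
      using ab by blast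
  qed (use pos rho_le zmin B in \<open>auto simp: space_M\<close>)
  then show ?thesis
    using \<Omega> by (simp add: set_lebesgue_integral_lebesgue_on minima_density_def M_def)
qed

text \<open>Outside the open ball of radius \<open>\<epsilon>\<close> the rest of
  \<open>\<Omega>\<close> is compact, so \<open>f\<close> attains a minimum there, which by
  uniqueness exceeds \<open>f z\<close>; the gap serves as \<open>\<delta>\<close>. If nothing of
  \<open>\<Omega>\<close> is left outside the ball, any \<open>\<delta>\<close> works.\<close>

lemma near_unique_minimizer:
  fixes f :: "'a::metric_space \<Rightarrow> real"
  assumes comp: "compact \<Omega>" and f: "continuous_on \<Omega> f"
    and z: "unique_global_minimizer f \<Omega> z" and \<epsilon>: "\<epsilon> > 0"
  shows "\<exists>\<delta>>0. \<forall>x\<in>\<Omega>. f x < f z + \<delta> \<longrightarrow> dist x z \<le> \<epsilon>"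
proof (cases "\<Omega> - ball z \<epsilon> = {}")
  case True
  then have "\<forall>x\<in>\<Omega>. dist x z \<le> \<epsilon>" by (auto simp: dist_commute less_imp_le)
  then show ?thesis using zero_less_one by blast
next
  case False
  have "compact (\<Omega> - ball z \<epsilon>)" using comp by (simp add: compact_diff)
  then obtain y where y: "y \<in> \<Omega> - ball z \<epsilon>" "\<And>x. x \<in> \<Omega> - ball z \<epsilon> \<Longrightarrow> f y \<le> f x"
    using continuous_attains_inf[of "\<Omega> - ball z \<epsilon>" f] False continuous_on_subset[OF f]
    by (metis Diff_subset)
  have zmin: "\<forall>x\<in>\<Omega>. f z \<le> f x"
    using z by (simp add: unique_global_minimizer_def global_minimizer_iff)
  have "y \<noteq> z" using y(1) \<epsilon> by auto
  then have "\<not> global_minimizer f \<Omega> y"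
    using z by (auto simp: unique_global_minimizer_def)
  then have "f z < f y"
    using y(1) zmin by (fastforce simp: global_minimizer_iff)
  moreover have "dist x z \<le> \<epsilon>" if "x \<in> \<Omega>" "f x < f z + (f y - f z)" for x
    using y(2)[of x] that by (force simp: dist_commute)
  ultimately show ?thesis by (intro exI[of _ "f y - f z"]) auto
qed

theorem theorem2:
  fixes \<Omega> :: "(real ^ 'n) set"
    and f :: "real ^ 'n \<Rightarrow> real"
    and \<rho> :: "real \<Rightarrow> real"
  assumes "compact \<Omega>"
    and "measure lebesgue \<Omega> > 0"
    and "continuous_on \<Omega> f"
    and "strict_antimono_on UNIV \<rho>"
    and "\<And>x. x \<in> \<Omega> \<Longrightarrow> \<rho> (f x) > 0"
    and "\<exists>x. global_minimizer f \<Omega> x \<and> in_measure_support \<Omega> x"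
  shows "((\<lambda>k. LINT x:\<Omega>|lebesgue. f x * minima_density \<Omega> (\<lambda>t. \<rho> (f t)) k x)
           \<longlongrightarrow> min_value f \<Omega>) at_top \<and>
         (\<forall>xstar. unique_global_minimizer f \<Omega> xstar \<longrightarrow>
           ((\<lambda>k. LINT x:\<Omega>|lebesgue. minima_density \<Omega> (\<lambda>t. \<rho> (f t)) k x *\<^sub>R x)
             \<longlongrightarrow> xstar) at_top)"
proof -
  obtain z where z: "global_minimizer f \<Omega> z" "in_measure_support \<Omega> z"
    using assms(6) by blast
  note conc = minima_density_concentrates[OF assms(1,3) _ assms(4,5) z]
  have "((\<lambda>k. LINT x:\<Omega>|lebesgue. minima_density \<Omega> (\<lambda>t. \<rho> (f t)) k x *\<^sub>R f x) \<longlongrightarrow> f z) at_top"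
  proof (rule conc)
    fix \<epsilon> :: real assume "\<epsilon> > 0"
    moreover have "dist (f x) (f z) \<le> \<epsilon>" if "x \<in> \<Omega>" "f x < f z + \<epsilon>" for x
      using z(1) that by (force simp: global_minimizer_iff dist_real_def)
    ultimately show "\<exists>\<delta>>0. \<forall>x\<in>\<Omega>. f x < f z + \<delta> \<longrightarrow> dist (f x) (f z) \<le> \<epsilon>"
      by blast
  qed (use assms(3) in auto)
  moreover have "((\<lambda>k. LINT x:\<Omega>|lebesgue. minima_density \<Omega> (\<lambda>t. \<rho> (f t)) k x *\<^sub>R x) \<longlongrightarrow> xstar) at_top"
    if xstar: "unique_global_minimizer f \<Omega> xstar" for xstar
  proof (rule conc)
    \<comment> \<open>Uniqueness identifies \<open>xstar\<close> with the minimizer \<open>z\<close>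
      known to lie in the measure support.\<close>
    have "z = xstar" using xstar z(1) by (simp add: unique_global_minimizer_def)
    then show "\<exists>\<delta>>0. \<forall>x\<in>\<Omega>. f x < f z + \<delta> \<longrightarrow> dist x xstar \<le> \<epsilon>" if "\<epsilon> > 0" for \<epsilon>
      using near_unique_minimizer[OF assms(1,3) xstar that] by simp
  qed (auto intro: continuous_intros)
  ultimately show ?thesis
    by (simp add: min_value_eq[OF z(1)] mult.commute)
qed

end
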